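(* Let $r\ge 2$ and $k\ge 1$ be fixed integers, and let $F_r$ be the free group of rank $r$. Purity is exponentially generic in the word-based distribution; that is, there exists a constant $c>0$ such that, as $n\to\infty$, $$\frac{\left|\{\vec h=(h_1,\dots,h_k)\in R_n^k : \langle h_1,\dots,h_k\rangle \text{ is not a pure subgroup of } F_r\}\right|}{|R_n|^k}=O(e^{-cn}).$$
   Context: $F_r=F(A)$ is the free group over an alphabet $A$ with $r$ letters; its elements are represented by reduced words over $A\cup A^{-1}$. $R_n$ denotes the set of reduced words of length at most $n$. In the word-based distribution, $k$ is fixed, a $k$-tuple $\vec h=(h_1,\dots,h_k)$ is chosen uniformly at random in $R_n^k$, and one considers the subgroup it generates. A property is exponentially generic if the proportion of $k$-tuples in $R_n^k$ failing it is $O(e^{-cn})$ for some $c>0$. A subgroup $H$ of $F_r$ is pure if, for all $x\in F_r$ and all integers $m\neq 0$, $x^m\in H$ implies $x\in H$. *)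

theory Defs
  imports "HOL-Algebra.Generated_Groups" "HOL-Library.Landau_Symbols"
begin

text \<open>A letter \<open>(a, False)\<close> stands for \<open>a\<close>, and \<open>(a, True)\<close> for \<open>a\<^sup>-\<^sup>1\<close>.\<close>

type_synonym 'a letter = "'a \<times> bool"

definition inv_letter :: "'a letter \<Rightarrow> 'a letter" where
  "inv_letter x = (fst x, \<not> snd x)"

definition reduced :: "'a letter list \<Rightarrow> bool" where
  "reduced w \<longleftrightarrow> successively (\<lambda>x y. y \<noteq> inv_letter x) w"

definition reduced_words :: "'a set \<Rightarrow> 'a letter list set" where
  "reduced_words A = {w. set w \<subseteq> A \<times> UNIV \<and> reduced w}"

definition reduced_words_upto :: "'a set \<Rightarrow> nat \<Rightarrow> 'a letter list set" where
  "reduced_words_upto A n = {w \<in> reduced_words A. length w \<le> n}"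

fun cons_reduce :: "'a letter \<Rightarrow> 'a letter list \<Rightarrow> 'a letter list" where
  "cons_reduce x [] = [x]"
| "cons_reduce x (y # w) = (if y = inv_letter x then w else x # y # w)"

definition free_reduce :: "'a letter list \<Rightarrow> 'a letter list" where
  "free_reduce w = foldr cons_reduce w []"

definition free_group :: "'a set \<Rightarrow> 'a letter list monoid" where
  "free_group A = \<lparr>carrier = reduced_words A, mult = (\<lambda>u v. free_reduce (u @ v)), one = []\<rparr>"

definition pure_subgroup :: "'b set \<Rightarrow> ('b, 'c) monoid_scheme \<Rightarrow> bool" where
  "pure_subgroup H G \<longleftrightarrow> subgroup H G \<and>
     (\<forall>x \<in> carrier G. \<forall>m::int. m \<noteq> 0 \<longrightarrow> x [^]\<^bsub>G\<^esub> m \<in> H \<longrightarrow> x \<in> H)"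

definition tuples :: "nat \<Rightarrow> 'b set \<Rightarrow> 'b list set" where
  "tuples k S = {hs. length hs = k \<and> set hs \<subseteq> S}"

lemma inv_letter_inv_letter [simp]: "inv_letter (inv_letter x) = x"
  by (simp add: inv_letter_def)

lemma reduced_cons_reduce: "reduced w \<Longrightarrow> reduced (cons_reduce x w)"
  by (cases w) (auto simp: reduced_def successively_Cons)

lemma set_cons_reduce: "set (cons_reduce x w) \<subseteq> insert x (set w)"
  by (cases w) auto

lemma cons_reduce_inv: "reduced w \<Longrightarrow> cons_reduce x (cons_reduce (inv_letter x) w) = w"
  by (cases w; cases "tl w") (auto simp: reduced_def)

lemma reduced_foldr: "reduced w \<Longrightarrow> reduced (foldr cons_reduce u w)"
  by (induction u) (auto simp: reduced_cons_reduce)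

lemma set_foldr: "set (foldr cons_reduce u w) \<subseteq> set u \<union> set w"
proof (induction u)
  case (Cons x u)
  then show ?case using set_cons_reduce[of x "foldr cons_reduce u w"] by auto
qed simp

lemma free_reduce_reduced: "reduced w \<Longrightarrow> free_reduce w = w"
proof (induction w)
  case (Cons x w)
  then show ?case
    by (cases w) (auto simp: free_reduce_def reduced_def)
qed (simp add: free_reduce_def)

lemma foldr_cons_reduce:
  assumes "reduced w"
  shows "foldr cons_reduce (cons_reduce x v) w = cons_reduce x (foldr cons_reduce v w)"
proof (cases v)
  case (Cons y ys)
  then show ?thesis
    using cons_reduce_inv[OF reduced_foldr[OF assms]] by auto
qed simp

lemma foldr_foldr:
  assumes "reduced w"
  shows "foldr cons_reduce (foldr cons_reduce u v) w = foldr cons_reduce u (foldr cons_reduce v w)"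
  by (induction u) (simp_all add: foldr_cons_reduce[OF assms])

lemma free_reduce_append: "reduced v \<Longrightarrow> free_reduce (u @ v) = foldr cons_reduce u v"
  using free_reduce_reduced[of v] by (simp add: free_reduce_def)

lemma reduced_free_reduce: "reduced (free_reduce w)"
  unfolding free_reduce_def by (rule reduced_foldr) (simp add: reduced_def)

lemma free_reduce_closed: "set w \<subseteq> A \<times> UNIV \<Longrightarrow> free_reduce w \<in> reduced_words A"
  using set_foldr[of w "[]"] reduced_free_reduce[of w]
  by (auto simp: reduced_words_def free_reduce_def)

lemma foldr_inverse:
  "reduced v \<Longrightarrow> foldr cons_reduce (rev (map inv_letter u)) (foldr cons_reduce u v) = v"
proof (induction u)
  case (Cons x u)
  then show ?case
    using cons_reduce_inv[OF reduced_foldr[OF Cons.prems], of "inv_letter x" u] by simp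
qed simp

lemma reduced_inverse: "reduced u \<Longrightarrow> reduced (rev (map inv_letter u))"
  unfolding reduced_def successively_rev successively_map
  by (erule successively_mono) auto

lemma group_free_group: "group (free_group A)"
proof (rule groupI)
  fix u v assume "u \<in> carrier (free_group A)" "v \<in> carrier (free_group A)"
  then show "u \<otimes>\<^bsub>free_group A\<^esub> v \<in> carrier (free_group A)"
    by (auto simp: free_group_def reduced_words_def[of A] intro!: free_reduce_closed[unfolded reduced_words_def, simplified])
next
  show "\<one>\<^bsub>free_group A\<^esub> \<in> carrier (free_group A)"
    by (simp add: free_group_def reduced_words_def reduced_def)
next
  fix u v w
  assume "u \<in> carrier (free_group A)" "v \<in> carrier (free_group A)" "w \<in> carrier (free_group A)"
  then have r: "reduced u" "reduced v" "reduced w"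
    by (auto simp: free_group_def reduced_words_def)
  show "u \<otimes>\<^bsub>free_group A\<^esub> v \<otimes>\<^bsub>free_group A\<^esub> w = u \<otimes>\<^bsub>free_group A\<^esub> (v \<otimes>\<^bsub>free_group A\<^esub> w)"
    by (simp add: free_group_def free_reduce_append r reduced_foldr foldr_foldr)
next
  fix u assume "u \<in> carrier (free_group A)"
  then show "\<one>\<^bsub>free_group A\<^esub> \<otimes>\<^bsub>free_group A\<^esub> u = u"
    by (simp add: free_group_def reduced_words_def free_reduce_reduced)
next
  fix u assume u: "u \<in> carrier (free_group A)"
  let ?v = "rev (map inv_letter u)"
  have r: "reduced u" and s: "set u \<subseteq> A \<times> UNIV"
    using u by (auto simp: free_group_def reduced_words_def)
  have "?v \<in> carrier (free_group A)"
    using reduced_inverse[OF r] s by (auto simp: free_group_def reduced_words_def inv_letter_def)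
  moreover have "?v \<otimes>\<^bsub>free_group A\<^esub> u = \<one>\<^bsub>free_group A\<^esub>"
    using foldr_inverse[of "[]" u] free_reduce_reduced[OF r]
    by (simp add: free_group_def free_reduce_def reduced_def)
  ultimately show "\<exists>v\<in>carrier (free_group A). v \<otimes>\<^bsub>free_group A\<^esub> u = \<one>\<^bsub>free_group A\<^esub>"
    by blast
qed

end

theory Submission
  imports Defs "HOL-Real_Asymp.Real_Asymp"
begin

text \<open>
  Long factors of random words do not repeat.  For a generic tuple \<open>(h\<^sub>1, \<dots>, h\<^sub>k)\<close> there is a
  length \<open>l\<close>, a fixed fraction of \<open>n\<close>, such that every \<open>h\<^sub>i\<close> has length at least \<open>5 l\<close> and no word
  of length \<open>l\<close> occurs at two different places in the words \<open>h\<^sub>i\<close> and \<open>h\<^sub>i\<^sup>-\<^sup>1\<close>.  The theorem follows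
  from two facts: such a tuple generates a pure subgroup, and all other tuples are rare.

  Purity.  Let \<open>H\<close> be generated by such a tuple.  In a product of the \<open>h\<^sub>i\<close> and their inverses in
  which no generator meets its own inverse, fewer than \<open>l\<close> letters cancel at each junction, since a
  longer cancellation would be a repeated factor.  The reduced form \<open>w\<close> of the product is
  therefore a chain of long pieces of generators.  At most positions \<open>p\<close> the window of \<open>l\<close>
  letters starting there lies in one piece; then the window determines the generator and the place
  inside it, and the prefix \<open>take p w\<close> is an element of \<open>H\<close> times a prefix of that generator
  (\<open>product_word_on_track\<close>).  Now let \<open>x\<^sup>m \<in> H\<close> with \<open>m > 0\<close>, and write \<open>x = g y g\<^sup>-\<^sup>1\<close> with \<open>y\<close>
  cyclically reduced.  A high power of \<open>x\<^sup>m\<close> has the reduced form \<open>w = g y \<dots> y g\<^sup>-\<^sup>1\<close>, so moving a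
  window by one period \<open>length y\<close> does not change it, while left multiplication by \<open>x\<close> takes the
  prefix before the window to the prefix before the moved one.  If both windows lie in pieces, they
  sit at the same place of the same generator; the two prefixes then differ by an element of
  \<open>H\<close> on the left, and this element is \<open>x\<close> (\<open>shift_in_H\<close>, \<open>nat_root_in_H\<close>).

  Rarity.  Put \<open>d = 2 r - 1\<close>; there are about \<open>d\<^sup>n\<close> reduced words of length at most \<open>n\<close>.  If a factor
  repeats, a block of letters of one word of the tuple is a function of letters that come before it in
  that word or belong to another word, and this forfeits a factor \<open>d\<close> for each letter of the block
  (\<open>card_block_determined\<close>, \<open>card_tuples_block_copied\<close>).  With \<open>l = 2 s\<close> and \<open>s = n div 16\<close> blocks of
  length \<open>s\<close> are determined in this way; a word shorter than \<open>5 l\<close> also forfeits at least \<open>s\<close> letters.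
  Only polynomially many choices of the two places exist, so the proportion of bad tuples is at most
  a polynomial in \<open>n\<close> times \<open>d\<^sup>-\<^sup>s\<close> (\<open>card_impure_tuples\<close>).
\<close>

section \<open>Reduced words and cancellation\<close>

definition word_inv :: "'a letter list \<Rightarrow> 'a letter list" where
  "word_inv u = rev (map inv_letter u)"

abbreviation window :: "nat \<Rightarrow> nat \<Rightarrow> 'b list \<Rightarrow> 'b list" where
  "window l p w \<equiv> take l (drop p w)"

lemma inv_letter_neq: "inv_letter a \<noteq> a"
  by (cases a) (auto simp: inv_letter_def)

lemma word_inv_simps [simp]:
  "word_inv [] = []" "length (word_inv u) = length u" "word_inv (word_inv u) = u"
  "word_inv (u @ v) = word_inv v @ word_inv u"
  by (auto simp: word_inv_def rev_map o_def)

lemma window_word_inv: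
  assumes "p + l \<le> length w"
  shows "window l p (word_inv w) = word_inv (window l (length w - p - l) w)"
  using assms
  by (auto simp: word_inv_def drop_rev take_rev drop_map take_map take_drop intro!: arg_cong2[where f = drop])

lemma reduced_append:
  "reduced (u @ v) \<longleftrightarrow> reduced u \<and> reduced v \<and> (u \<noteq> [] \<longrightarrow> v \<noteq> [] \<longrightarrow> hd v \<noteq> inv_letter (last u))"
  by (auto simp: reduced_def successively_append_iff)

lemma reduced_word_inv [simp]: "reduced (word_inv u) \<longleftrightarrow> reduced u"
  using reduced_inverse[of u] reduced_inverse[of "word_inv u"]
  by (metis word_inv_def word_inv_simps(3))

lemma set_word_inv: "set u \<subseteq> A \<times> UNIV \<Longrightarrow> set (word_inv u) \<subseteq> A \<times> UNIV"
  by (auto simp: word_inv_def inv_letter_def)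

lemma carrier_free_group: "carrier (free_group A) = reduced_words A"
  by (simp add: free_group_def)

lemma word_inv_in_reduced_words: "u \<in> reduced_words A \<Longrightarrow> word_inv u \<in> reduced_words A"
  using set_word_inv[of u A] by (simp add: reduced_words_def)

lemma append_in_reduced_words:
  "u @ v \<in> reduced_words A \<Longrightarrow> u \<in> reduced_words A \<and> v \<in> reduced_words A"
  by (auto simp: reduced_words_def reduced_append)

lemma take_in_reduced_words: "u \<in> reduced_words A \<Longrightarrow> take p u \<in> reduced_words A"
  using append_in_reduced_words[of "take p u" "drop p u" A] by simp

lemma mult_append:
  assumes "reduced (u @ v)"
  shows "u \<otimes>\<^bsub>free_group A\<^esub> v = u @ v"
  using free_reduce_reduced[OF assms] by (simp add: free_group_def)

lemma one_free_group: "\<one>\<^bsub>free_group A\<^esub> = []"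
  by (simp add: free_group_def)

lemma inv_free_group:
  assumes "u \<in> reduced_words A"
  shows "inv\<^bsub>free_group A\<^esub> u = word_inv u"
proof -
  interpret group "free_group A" by (rule group_free_group)
  have r: "reduced u" using assms by (simp add: reduced_words_def)
  have "word_inv u \<otimes>\<^bsub>free_group A\<^esub> u = \<one>\<^bsub>free_group A\<^esub>"
    using foldr_inverse[of "[]" u] free_reduce_reduced[OF r]
    by (simp add: free_group_def free_reduce_def reduced_def word_inv_def)
  then show ?thesis
    using assms word_inv_in_reduced_words[OF assms] by (simp add: inv_equality carrier_free_group)
qed

text \<open>Makes the cancelled part \<open>c\<close> of a product of two reduced words available as a common factor of
  one word and of the inverse of the other, so that a bound on common factors bounds its length.\<close>

lemma maximal_cancellation:
  assumes "reduced u" "reduced v"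
  obtains u' c v' where "u = u' @ c" "v = word_inv c @ v'" "reduced (u' @ v')"
proof -
  have "\<exists>u' c v'. u = u' @ c \<and> v = word_inv c @ v' \<and> reduced (u' @ v')"
    using assms
  proof (induction u arbitrary: v rule: rev_induct)
    case Nil
    then show ?case by (metis append_Nil word_inv_simps(1))
  next
    case (snoc x u)
    show ?case
    proof (cases "v \<noteq> [] \<and> hd v = inv_letter x")
      case True
      then obtain w where w: "v = inv_letter x # w" by (cases v) auto
      have "reduced u" "reduced w"
        using snoc.prems w reduced_append[of "[inv_letter x]" w] by (auto simp: reduced_append)
      from snoc.IH[OF this] obtain u' c v' where
        "u = u' @ c" "w = word_inv c @ v'" "reduced (u' @ v')" by blast
      then have "u @ [x] = u' @ (c @ [x]) \<and> v = word_inv (c @ [x]) @ v' \<and> reduced (u' @ v')"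
        using w by (simp add: word_inv_def)
      then show ?thesis by blast
    next
      case False
      then have "u @ [x] = (u @ [x]) @ [] \<and> v = word_inv [] @ v \<and> reduced ((u @ [x]) @ v)"
        using snoc.prems reduced_append[of "u @ [x]" v] by fastforce
      then show ?thesis by blast
    qed
  qed
  then show ?thesis using that by blast
qed

lemma mult_cancel:
  assumes "u @ c \<in> reduced_words A" "word_inv c @ v \<in> reduced_words A" "reduced (u @ v)"
  shows "(u @ c) \<otimes>\<^bsub>free_group A\<^esub> (word_inv c @ v) = u @ v"
proof -
  interpret group "free_group A" by (rule group_free_group)
  have mem: "u \<in> reduced_words A" "c \<in> reduced_words A" "word_inv c \<in> reduced_words A"
    "v \<in> reduced_words A"
    using assms append_in_reduced_words[of u c A] append_in_reduced_words[of "word_inv c" v A] by auto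
  note mem' = mem[folded carrier_free_group]
  have "(u @ c) \<otimes>\<^bsub>free_group A\<^esub> (word_inv c @ v)
      = (u \<otimes>\<^bsub>free_group A\<^esub> c) \<otimes>\<^bsub>free_group A\<^esub> (inv\<^bsub>free_group A\<^esub> c \<otimes>\<^bsub>free_group A\<^esub> v)"
    using assms mem by (simp add: mult_append reduced_words_def inv_free_group)
  also have "\<dots> = u \<otimes>\<^bsub>free_group A\<^esub> v"
  proof -
    have "c \<otimes>\<^bsub>free_group A\<^esub> (inv\<^bsub>free_group A\<^esub> c \<otimes>\<^bsub>free_group A\<^esub> v) = v"
      using mem' by (simp flip: m_assoc)
    then show ?thesis using mem' by (simp add: m_assoc)
  qed
  also have "\<dots> = u @ v" using assms by (simp add: mult_append)
  finally show ?thesis .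
qed

section \<open>Powers of a reduced word\<close>

text \<open>If \<open>x @ x\<close> is not reduced, the first letter of \<open>x\<close> is the inverse of the last one, and both can
  be moved into the conjugator.\<close>

lemma cyclic_reduction:
  assumes "reduced x"
  obtains g y where "x = g @ y @ word_inv g" "reduced (y @ y)"
proof -
  have "\<exists>g y. x = g @ y @ word_inv g \<and> reduced (y @ y)"
    using assms
  proof (induction x rule: length_induct)
    case (1 x)
    show ?case
    proof (cases "reduced (x @ x)")
      case True
      then show ?thesis by (metis append_Nil append_Nil2 word_inv_simps(1))
    next
      case False
      then have ne: "x \<noteq> []" and hl: "hd x = inv_letter (last x)"
        using 1 by (auto simp: reduced_append)
      then obtain a z where x: "x = a # z" "z \<noteq> []"
        using inv_letter_neq by (metis last_ConsL list.collapse)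
      then obtain b w where z: "z = w @ [b]" by (cases z rule: rev_exhaust) auto
      have b: "b = inv_letter a" using hl x z by simp
      have "reduced w" using 1(2) x z reduced_append[of "[a]" z] reduced_append[of w "[b]"] by simp
      with 1(1) x z obtain g y where "w = g @ y @ word_inv g" "reduced (y @ y)"
        by (metis length_append_singleton length_Cons less_Suc_eq)
      then have "x = (a # g) @ y @ word_inv (a # g)"
        using x z b by (simp add: word_inv_def)
      with \<open>reduced (y @ y)\<close> show ?thesis by blast
    qed
  qed
  then show ?thesis using that by blast
qed

text \<open>The prefix \<open>u\<close> is arbitrary so that, in the induction, one period can be passed to it.\<close>

lemma reduced_power:
  assumes "reduced (y @ y)" "reduced (y @ v)" "y \<noteq> []" "reduced (u @ y)"
  shows "reduced (u @ concat (replicate (Suc n) y) @ v)"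
  using assms(4)
proof (induction n arbitrary: u)
  case 0
  then show ?case using assms by (auto simp: reduced_append)
next
  case (Suc n)
  have "reduced (y @ concat (replicate (Suc n) y) @ v)" by (rule Suc.IH) (rule assms)
  then show ?case using Suc.prems assms(3)
    by (subst replicate_Suc, subst concat.simps) (simp add: reduced_append del: replicate_Suc)
qed

lemma pow_conjugate:
  assumes x: "g @ y @ word_inv g \<in> reduced_words A" and yy: "reduced (y @ y)" and ne: "y \<noteq> []"
  shows "(g @ y @ word_inv g) [^]\<^bsub>free_group A\<^esub> Suc n
    = g @ concat (replicate (Suc n) y) @ word_inv g"
proof (induction n)
  case 0
  interpret group "free_group A" by (rule group_free_group)
  show ?case using x by (simp add: carrier_free_group)
next
  case (Suc n)
  let ?Y = "concat (replicate (Suc n) y)"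
  have r: "reduced (g @ ?Y @ word_inv g)" "reduced (g @ ?Y @ y @ word_inv g)"
    using reduced_power[of y "word_inv g" g n] reduced_power[of y "y @ word_inv g" g n] x yy ne
    by (auto simp: reduced_words_def reduced_append)
  have s: "set ?Y \<subseteq> set y" by auto
  have c: "concat (replicate (Suc (Suc n)) y) = ?Y @ y"
    by (simp add: replicate_append_same flip: concat_append)
      (metis append.right_neutral concat.simps concat_append replicate_append_same)
  have "(g @ y @ word_inv g) [^]\<^bsub>free_group A\<^esub> Suc (Suc n)
      = ((g @ ?Y) @ word_inv g) \<otimes>\<^bsub>free_group A\<^esub> (word_inv (word_inv g) @ (y @ word_inv g))"
    using Suc by (simp only: monoid.nat_pow_Suc[OF group.is_monoid[OF group_free_group]]) simp
  also have "\<dots> = (g @ ?Y) @ (y @ word_inv g)"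
    by (rule mult_cancel) (use r x s in \<open>auto simp: reduced_words_def\<close>)
  finally show ?case by (simp only: c append_assoc)
qed


section \<open>Tuples with distinct long factors\<close>

text \<open>The index \<open>i\<close> of a generator together with a sign is a letter of the alphabet of indices, so a
  formal product of generators is a word over this alphabet and can itself be freely reduced.\<close>

definition signed_word :: "'a letter list list \<Rightarrow> nat letter \<Rightarrow> 'a letter list" where
  "signed_word hs a = (if snd a then word_inv (hs ! fst a) else hs ! fst a)"

text \<open>Occurrences in the inverses of the words are translated into occurrences of the inverse factor
  in the words themselves, so that only the words of the tuple have to be looked at when counting;
  \<open>signed_word_window_unique\<close> translates back.\<close>

definition distinct_windows :: "nat \<Rightarrow> 'a letter list list \<Rightarrow> bool" where
  "distinct_windows l hs \<longleftrightarrow> (\<forall>i < length hs. \<forall>j < length hs. \<forall>p q.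
     p + l \<le> length (hs ! i) \<longrightarrow> q + l \<le> length (hs ! j) \<longrightarrow>
       (window l p (hs ! i) = window l q (hs ! j) \<longrightarrow> i = j \<and> p = q) \<and>
       window l p (hs ! i) \<noteq> word_inv (window l q (hs ! j)))"

lemma signed_word_window_unique:
  assumes d: "distinct_windows l hs" and ij: "fst a < length hs" "fst b < length hs"
    and p: "p + l \<le> length (signed_word hs a)" and q: "q + l \<le> length (signed_word hs b)"
    and eq: "window l p (signed_word hs a) = window l q (signed_word hs b)"
  shows "a = b \<and> p = q"
proof -
  obtain i e j f where ab: "a = (i, e)" "b = (j, f)" by (cases a, cases b) auto
  have D1: "window l p' (hs ! i) = window l q' (hs ! j) \<Longrightarrow> i = j \<and> p' = q'"
    and D2: "window l p' (hs ! i) \<noteq> word_inv (window l q' (hs ! j))"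
    if "p' + l \<le> length (hs ! i)" "q' + l \<le> length (hs ! j)" for p' q'
    using d ij that ab unfolding distinct_windows_def by auto
  have len: "p + l \<le> length (hs ! i)" "q + l \<le> length (hs ! j)"
    using p q ab by (auto simp: signed_word_def split: if_splits)
  let ?p = "length (hs ! i) - p - l" and ?q = "length (hs ! j) - q - l"
  have len': "?p + l \<le> length (hs ! i)" "?q + l \<le> length (hs ! j)" using len by auto
  consider "\<not> e" "\<not> f" | "e" "f" | "e" "\<not> f" | "\<not> e" "f" by blast
  then show ?thesis
  proof cases
    case 1
    then show ?thesis using D1[OF len] eq ab by (auto simp: signed_word_def)
  next
    case 2
    then have "word_inv (window l ?p (hs ! i)) = word_inv (window l ?q (hs ! j))"
      using eq ab len by (simp add: signed_word_def window_word_inv)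
    then have "window l ?p (hs ! i) = window l ?q (hs ! j)" by (metis word_inv_simps(3))
    with D1[OF len'] have "i = j" "?p = ?q" by auto
    then show ?thesis using len 2 ab by auto
  next
    case 3
    then have "word_inv (window l ?p (hs ! i)) = window l q (hs ! j)"
      using eq ab len by (simp add: signed_word_def window_word_inv)
    then have "window l ?p (hs ! i) = word_inv (window l q (hs ! j))" by (metis word_inv_simps(3))
    with D2[OF len'(1) len(2)] show ?thesis by blast
  next
    case 4
    then have "window l p (hs ! i) = word_inv (window l ?q (hs ! j))"
      using eq ab len by (simp add: signed_word_def window_word_inv)
    with D2[OF len(1) len'(2)] show ?thesis by blast
  qed
qed

text \<open>The constant 5 guarantees, after fewer than \<open>l\<close> letters are cancelled on each side of a
  generator, a remaining piece so long that of three windows with starting points \<open>p\<close>, \<open>p + l\<close>,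
  \<open>p + 2 * l\<close> at most one crosses a junction.\<close>

locale separated_tuple =
  fixes A :: "'a set" and hs :: "'a letter list list" and l :: nat
  assumes words: "set hs \<subseteq> reduced_words A"
    and windows: "distinct_windows l hs"
    and long: "\<And>h. h \<in> set hs \<Longrightarrow> 5 * l \<le> length h"
begin

abbreviation "G \<equiv> free_group A"
abbreviation "H \<equiv> generate G (set hs)"
abbreviation "word \<equiv> signed_word hs"

definition product_word :: "nat letter list \<Rightarrow> 'a letter list" where
  "product_word ws = foldr (\<lambda>a w. word a \<otimes>\<^bsub>G\<^esub> w) ws []"

lemma product_word_simps [simp]:
  "product_word [] = []" "product_word (a # ws) = word a \<otimes>\<^bsub>G\<^esub> product_word ws"
  by (simp_all add: product_word_def)

interpretation group G by (rule group_free_group)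

lemma subgroup_H: "subgroup H G"
  using words by (intro generate_is_subgroup) (simp add: carrier_free_group)

lemmas H_in_carrier = subgroup.mem_carrier[OF subgroup_H]

lemma word_in_reduced_words: "fst a < length hs \<Longrightarrow> word a \<in> reduced_words A"
  using words word_inv_in_reduced_words[of "hs ! fst a" A] nth_mem[of "fst a" hs]
  unfolding signed_word_def by (metis subsetD)

lemma word_in_carrier: "fst a < length hs \<Longrightarrow> word a \<in> carrier G"
  using word_in_reduced_words by (simp add: carrier_free_group)

lemma length_word: "fst a < length hs \<Longrightarrow> 5 * l \<le> length (word a)"
  using long by (auto simp: signed_word_def)

lemma word_inv_letter: "word (inv_letter a) = word_inv (word a)"
  by (simp add: signed_word_def inv_letter_def)

lemma word_in_H:
  assumes "fst a < length hs" shows "word a \<in> H"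
proof -
  have h: "hs ! fst a \<in> H" using assms by (intro generate.incl) simp
  moreover have "word_inv (hs ! fst a) = inv\<^bsub>G\<^esub> (hs ! fst a)"
    using words assms by (intro inv_free_group[symmetric]) auto
  ultimately show ?thesis using subgroup_H by (simp add: signed_word_def subgroup.m_inv_closed)
qed

lemma product_word_in_carrier:
  "set ws \<subseteq> {..<length hs} \<times> UNIV \<Longrightarrow> product_word ws \<in> carrier G"
proof (induction ws)
  case Nil
  then show ?case using one_closed by (simp add: one_free_group)
next
  case (Cons a ws)
  then show ?case using word_in_carrier[of a] by auto
qed

lemma product_word_cons_reduce:
  assumes "fst a < length hs" "set ws \<subseteq> {..<length hs} \<times> UNIV"
  shows "product_word (cons_reduce a ws) = word a \<otimes>\<^bsub>G\<^esub> product_word ws"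
proof (cases "\<exists>v. ws = inv_letter a # v")
  case True
  then obtain v where v: "ws = inv_letter a # v" by blast
  then have "product_word v \<in> carrier G" using assms product_word_in_carrier[of v] by auto
  moreover have "word (inv_letter a) = inv\<^bsub>G\<^esub> (word a)"
    using assms by (simp add: word_inv_letter inv_free_group word_in_reduced_words)
  ultimately show ?thesis using v assms word_in_carrier[of a]
    by (simp flip: m_assoc)
next
  case False
  then have "cons_reduce a ws = a # ws" by (cases ws) auto
  then show ?thesis by simp
qed

lemma product_word_foldr:
  assumes "set us \<subseteq> {..<length hs} \<times> UNIV" "set ws \<subseteq> {..<length hs} \<times> UNIV"
  shows "product_word (foldr cons_reduce us ws) = product_word us \<otimes>\<^bsub>G\<^esub> product_word ws"
  using assms(1)
proof (induction us)
  case Nil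
  then show ?case using product_word_in_carrier[OF assms(2)] l_one by (simp add: one_free_group)
next
  case (Cons a us)
  have "set (foldr cons_reduce us ws) \<subseteq> {..<length hs} \<times> UNIV"
    using set_foldr[of us ws] Cons.prems assms(2) by auto
  then show ?case
    using Cons word_in_carrier[of a] product_word_in_carrier[of us] product_word_in_carrier[OF assms(2)]
    by (auto simp: product_word_cons_reduce m_assoc)
qed

text \<open>The index word can be taken reduced: if a generator meets its own inverse, the pair is
  removed without changing the product.\<close>

lemma H_eq_product_word:
  assumes "x \<in> H"
  shows "\<exists>ws \<in> reduced_words {..<length hs}. x = product_word ws"
  using assms
proof (induction rule: generate.induct)
  case one
  then show ?case
    by (intro bexI[of _ "[]"]) (auto simp: one_free_group reduced_words_def reduced_def)
next
  case (incl h)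
  then obtain i where i: "i < length hs" "h = hs ! i" by (auto simp: in_set_conv_nth)
  then have "h \<otimes>\<^bsub>G\<^esub> [] = h" using word_in_carrier[of "(i, False)"] r_one[of h]
    by (simp add: one_free_group signed_word_def)
  then show ?case using i
    by (intro bexI[of _ "[(i, False)]"]) (auto simp: signed_word_def reduced_words_def reduced_def)
next
  case (inv h)
  then obtain i where i: "i < length hs" "h = hs ! i" by (auto simp: in_set_conv_nth)
  have w: "word_inv h = inv\<^bsub>G\<^esub> h" using inv words by (intro inv_free_group[symmetric]) auto
  then have "word_inv h \<otimes>\<^bsub>G\<^esub> [] = inv\<^bsub>G\<^esub> h"
    using word_in_carrier[of "(i, True)"] r_one[of "word_inv h"] i
    by (simp add: one_free_group signed_word_def)
  then show ?case using i
    by (intro bexI[of _ "[(i, True)]"]) (auto simp: signed_word_def reduced_words_def reduced_def)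
next
  case (eng x y)
  then obtain us ws where uw: "us \<in> reduced_words {..<length hs}" "x = product_word us"
    "ws \<in> reduced_words {..<length hs}" "y = product_word ws" by blast
  then have "foldr cons_reduce us ws \<in> reduced_words {..<length hs}"
    using set_foldr[of us ws] by (auto simp: reduced_words_def reduced_foldr)
  then show ?case using uw product_word_foldr[of us ws]
    by (intro bexI[of _ "foldr cons_reduce us ws"]) (auto simp: reduced_words_def)
qed

text \<open>In the Stallings graph of \<open>H\<close>, a bouquet of loops labelled by the generators and folded near
  the base point, this says that a path reading \<open>w\<close> from the base point reads the window at \<open>p\<close>
  without leaving the loop of one generator \<open>a\<close>, starting at its \<open>q\<close>-th vertex.\<close>

definition on_track :: "'a letter list \<Rightarrow> nat \<Rightarrow> bool" where
  "on_track w p \<longleftrightarrow> (\<exists>a q u. fst a < length hs \<and> q + l \<le> length (word a) \<and> u \<in> H \<and>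
     take p w = u \<otimes>\<^bsub>G\<^esub> take q (word a) \<and> window l p w = window l q (word a))"

text \<open>Induction on the number of factors, adding one on the left.  The first claim, that \<open>w\<close> begins
  with nearly all of the first generator, is what the induction needs: it shows that the cancellation
  with the new factor stays inside that generator and hence has length below \<open>l\<close>.\<close>

lemma product_word_on_track:
  assumes "reduced (a # ws)" "set (a # ws) \<subseteq> {..<length hs} \<times> UNIV"
  defines "w \<equiv> product_word (a # ws)"
  shows "take (length (word a) - l) w = take (length (word a) - l) (word a) \<and>
    (\<forall>p. p + 3 * l \<le> length w \<longrightarrow> on_track w p \<or> on_track w (p + l) \<and> on_track w (p + 2 * l))"
  using assms(1,2) unfolding w_def
proof (induction ws arbitrary: a)
  case Nil
  have a: "fst a < length hs" using Nil by auto
  then have w: "product_word [a] = word a"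
    using word_in_carrier[of a] r_one[of "word a"] by (simp add: one_free_group)
  have "on_track (word a) p" if "p + 3 * l \<le> length (word a)" for p
  proof -
    have "take p (word a) \<in> carrier G"
      using word_in_reduced_words[OF a] by (simp add: carrier_free_group take_in_reduced_words)
    then show ?thesis using that a unfolding on_track_def
      by (intro exI[of _ a] exI[of _ p] exI[of _ "\<one>\<^bsub>G\<^esub>"])
        (auto simp: generate.one)
  qed
  then show ?case unfolding w by simp
next
  case (Cons b ws)
  have a: "fst a < length hs" and b: "fst b < length hs" and ba: "b \<noteq> inv_letter a"
    using Cons.prems by (auto simp: reduced_def)
  let ?w' = "product_word (b # ws)" and ?w = "product_word (a # b # ws)"
  have IH: "take (length (word b) - l) ?w' = take (length (word b) - l) (word b)"
    "\<And>p. p + 3 * l \<le> length ?w' \<Longrightarrow>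
      on_track ?w' p \<or> on_track ?w' (p + l) \<and> on_track ?w' (p + 2 * l)"
    using Cons.IH[of b] Cons.prems by (auto simp: reduced_def simp del: product_word_simps)
  have w'c: "?w' \<in> reduced_words A"
    using product_word_in_carrier[of "b # ws"] Cons.prems by (auto simp: carrier_free_group)
  have wa: "word a \<in> reduced_words A" using word_in_reduced_words[OF a] .
  obtain u c v where uc: "word a = u @ c" and cv: "?w' = word_inv c @ v" and uv: "reduced (u @ v)"
    using maximal_cancellation[of "word a" ?w'] w'c wa by (auto simp: reduced_words_def)
  have w: "?w = u @ v"
    using mult_cancel[of u c A v] w'c wa uv unfolding uc cv
    by (simp only: product_word_simps(2)[of a] uc cv)
  have lb: "5 * l \<le> length (word b)" and la: "5 * l \<le> length (word a)"
    using length_word a b by auto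
  \<comment> \<open>Otherwise \<open>word b\<close> and the inverse of \<open>word a\<close> have a common prefix of length \<open>l\<close>.\<close>
  have c: "length c < l"
  proof (rule ccontr)
    assume "\<not> length c < l"
    then have lc: "l \<le> length c" by simp
    have "window l 0 (word (inv_letter a)) = take l ?w'"
      using lc by (simp add: word_inv_letter uc cv del: product_word_simps)
    also have "\<dots> = window l 0 (word b)"
      using arg_cong[OF IH(1), of "take l"] lb by (simp add: min_absorb1 del: product_word_simps)
    finally have "inv_letter a = b"
      using signed_word_window_unique[OF windows, of "inv_letter a" b 0 0] a b la lb
      by (simp add: word_inv_letter) (simp add: inv_letter_def)
    then show False using ba by simp
  qed
  have start: "on_track ?w' q" if "q + 2 * l \<le> length (word b)" for q
  proof -
    have "take q (word b) \<in> carrier G"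
      using word_in_reduced_words[OF b] by (simp add: carrier_free_group take_in_reduced_words)
    moreover have "take q ?w' = take q (word b)"
      using arg_cong[OF IH(1), of "take q"] that by (simp add: min_absorb1 del: product_word_simps)
    moreover have "window l q ?w' = window l q (word b)"
      using arg_cong[OF IH(1), of "\<lambda>x. drop q (take (q + l) x)"] that
      by (simp add: min_absorb1 take_drop add.commute del: product_word_simps)
    ultimately show ?thesis using that b unfolding on_track_def
      by (intro exI[of _ b] exI[of _ q] exI[of _ "\<one>\<^bsub>G\<^esub>"])
        (auto simp: generate.one)
  qed
  \<comment> \<open>Left multiplication by \<open>word a\<close> replaces the prefix \<open>word_inv c\<close> of the old word by \<open>u\<close>.\<close>
  have shift: "on_track ?w (q + length u - length c)"
    if good: "on_track ?w' q" and q: "length c \<le> q" for q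
  proof -
    from good obtain b' q' x where t: "fst b' < length hs" "q' + l \<le> length (word b')" "x \<in> H"
      "take q ?w' = x \<otimes>\<^bsub>G\<^esub> take q' (word b')" "window l q ?w' = window l q' (word b')"
      unfolding on_track_def by blast
    have x: "x \<in> carrier G" using t(3) by (rule H_in_carrier)
    have q'c: "take q' (word b') \<in> carrier G"
      using word_in_reduced_words[OF t(1)] by (simp add: carrier_free_group take_in_reduced_words)
    have d: "drop (q + length u - length c) ?w = drop q ?w'"
      using q by (simp add: w cv del: product_word_simps)
    have tk: "take (q + length u - length c) ?w = u @ take (q - length c) v"
      using q by (simp add: w cv del: product_word_simps)
    have tq: "take q ?w' = word_inv c @ take (q - length c) v"
      using q by (simp add: w cv del: product_word_simps)
    have ruv: "reduced (u @ take (q - length c) v)"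
      using uv reduced_append[of "u @ take (q - length c) v" "drop (q - length c) v"] by simp
    have "word a \<otimes>\<^bsub>G\<^esub> take q ?w' = take (q + length u - length c) ?w"
      unfolding tk tq uc
      by (rule mult_cancel) (use wa uc ruv take_in_reduced_words[OF w'c, of q] tq in auto)
    then have "take (q + length u - length c) ?w = (word a \<otimes>\<^bsub>G\<^esub> x) \<otimes>\<^bsub>G\<^esub> take q' (word b')"
      using t(4) x q'c word_in_carrier[OF a] by (simp add: m_assoc)
    moreover have "word a \<otimes>\<^bsub>G\<^esub> x \<in> H"
      using t(3) word_in_H[OF a] subgroup_H by (simp add: subgroup.m_closed)
    ultimately show ?thesis unfolding on_track_def using t(1,2,5) d by metis
  qed
  have "take (length (word a) - l) ?w = take (length (word a) - l) (word a)"
    unfolding w using c by (simp add: uc)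
  moreover have "on_track ?w p \<or> on_track ?w (p + l) \<and> on_track ?w (p + 2 * l)"
    if p: "p + 3 * l \<le> length ?w" for p
  proof -
    \<comment> \<open>The window ends before the new junction, or starts less than \<open>l\<close> letters before it, or starts
      after it.  In the second case the next two windows lie in the piece of \<open>word b\<close>.\<close>
    consider "p + l \<le> length u" | "p < length u" "length u < p + l" | "length u \<le> p" by linarith
    then show ?thesis
    proof cases
      case 1
      have "take p (word a) \<in> carrier G"
        using wa by (simp add: carrier_free_group take_in_reduced_words)
      moreover have "take p ?w = take p (word a)" "window l p ?w = window l p (word a)"
        unfolding w uc using 1 by auto
      ultimately have "on_track ?w p" using 1 a uc unfolding on_track_def
        by (intro exI[of _ a] exI[of _ p] exI[of _ "\<one>\<^bsub>G\<^esub>"])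
          (auto simp: generate.one)
      then show ?thesis by blast
    next
      case 2
      have "on_track ?w' (p + l + length c - length u)" "on_track ?w' (p + 2 * l + length c - length u)"
        by (rule start; use 2 c lb in linarith)+
      from shift[OF this(1)] shift[OF this(2)] show ?thesis using 2 by simp
    next
      case 3
      have len: "length ?w + length c = length ?w' + length u" unfolding w cv by simp
      let ?q = "p + length c - length u"
      have "?q + 3 * l \<le> length ?w'" using p 3 len by linarith
      from IH(2)[OF this] have "on_track ?w' ?q \<or> on_track ?w' (?q + l) \<and> on_track ?w' (?q + 2 * l)" .
      moreover have "on_track ?w (p + d)" if "on_track ?w' (?q + d)" for d
        using shift[OF that] 3 by (simp del: product_word_simps)
      ultimately show ?thesis by (metis add_0_right)
    qed
  qed
  ultimately show ?case by blast
qed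

text \<open>Equal windows sit at the same place of the same generator, so both prefixes end with the same
  prefix of that generator, which cancels from the equation.\<close>

lemma shift_in_H:
  assumes "on_track w p" "on_track w p'" "window l p w = window l p' w"
    and x: "x \<in> carrier G" "x \<otimes>\<^bsub>G\<^esub> take p w = take p' w"
  shows "x \<in> H"
proof -
  from assms(1) obtain a q u where t: "fst a < length hs" "q + l \<le> length (word a)" "u \<in> H"
      "take p w = u \<otimes>\<^bsub>G\<^esub> take q (word a)" "window l p w = window l q (word a)"
    unfolding on_track_def by blast
  from assms(2) obtain a' q' u' where t': "fst a' < length hs" "q' + l \<le> length (word a')" "u' \<in> H"
      "take p' w = u' \<otimes>\<^bsub>G\<^esub> take q' (word a')" "window l p' w = window l q' (word a')"
    unfolding on_track_def by blast
  have eq: "a = a'" "q = q'"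
    using signed_word_window_unique[OF windows t(1) t'(1) t(2) t'(2)] assms(3)
    unfolding t(5) t'(5) by auto
  let ?z = "take q (word a)"
  have z: "?z \<in> carrier G"
    using word_in_reduced_words[OF t(1)] by (simp add: carrier_free_group take_in_reduced_words)
  have u: "u \<in> carrier G" "u' \<in> carrier G" using t(3) t'(3) H_in_carrier by auto
  have "(x \<otimes>\<^bsub>G\<^esub> u) \<otimes>\<^bsub>G\<^esub> ?z = u' \<otimes>\<^bsub>G\<^esub> ?z"
    using x(2) x(1) u z unfolding t(4) t'(4) eq by (simp add: m_assoc)
  then have "x \<otimes>\<^bsub>G\<^esub> u = u'" using x u z by simp
  then have "x = u' \<otimes>\<^bsub>G\<^esub> inv\<^bsub>G\<^esub> u" using x u by (metis inv_solve_right)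
  then show ?thesis using t(3) t'(3) subgroup_H
    by (simp add: subgroup.m_closed subgroup.m_inv_closed)
qed

lemma nat_root_in_H:
  assumes x: "x \<in> carrier G" and m: "m > 0" and xm: "x [^]\<^bsub>G\<^esub> (m :: nat) \<in> H"
  shows "x \<in> H"
proof -
  have xr: "x \<in> reduced_words A" using x by (simp add: carrier_free_group)
  then obtain g y where xg: "x = g @ y @ word_inv g" and yy: "reduced (y @ y)"
    using cyclic_reduction[of x] by (auto simp: reduced_words_def)
  show ?thesis
  proof (cases "y = []")
    case True
    have "g \<in> carrier G" "inv\<^bsub>G\<^esub> g = word_inv g"
      using xr xg append_in_reduced_words[of g "y @ word_inv g" A]
      by (auto simp: carrier_free_group inv_free_group)
    moreover have "x = g \<otimes>\<^bsub>G\<^esub> word_inv g"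
      using xr xg True by (simp add: mult_append reduced_words_def)
    ultimately have "x = \<one>\<^bsub>G\<^esub>" by (metis r_inv)
    then show ?thesis by (simp add: generate.one)
  next
    case False
    \<comment> \<open>The exponent \<open>Suc n\<close> is the multiple \<open>m * (4 * l + 1)\<close> of \<open>m\<close>; it leaves at least \<open>4 * l\<close> letters
      of \<open>w\<close> besides one period, room for windows at offsets \<open>0\<close>, \<open>l\<close> and \<open>2 * l\<close>.\<close>
    define n where "n = 4 * l * m + (m - 1)"
    define v where "v = concat (replicate n y)"
    define w where "w = g @ concat (replicate (Suc n) y) @ word_inv g"
    have "concat (replicate (Suc n) y) = v @ y"
      unfolding v_def by (simp only: replicate_Suc replicate_append_same[symmetric] concat_append) simp
    then have w1: "w = g @ y @ v @ word_inv g" and w2: "w = g @ v @ y @ word_inv g"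
      by (simp_all add: w_def v_def)
    have "Suc n = m * (4 * l + 1)" using m by (simp add: n_def algebra_simps)
    then have "w = (x [^]\<^bsub>G\<^esub> m) [^]\<^bsub>G\<^esub> (4 * l + 1)"
      using pow_conjugate[of g y A n] xr yy False xg x unfolding w_def
      by (metis nat_pow_pow)
    moreover have "(x [^]\<^bsub>G\<^esub> m) [^]\<^bsub>G\<^esub> j \<in> H" for j :: nat
      by (induction j) (use xm subgroup_H in \<open>auto simp: generate.one intro: subgroup.m_closed\<close>)
    ultimately have "w \<in> H" by metis
    then obtain ws where ws: "ws \<in> reduced_words {..<length hs}" "w = product_word ws"
      using H_eq_product_word by blast
    have "w \<noteq> []" using False by (simp add: w1)
    then obtain b bs where b: "ws = b # bs" using ws by (cases ws) auto
    have W: "on_track w p \<or> on_track w (p + l) \<and> on_track w (p + 2 * l)"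
      if "p + 3 * l \<le> length w" for p
      using product_word_on_track[of b bs] ws b that by (auto simp: reduced_words_def simp del: product_word_simps)
    have lv: "4 * l \<le> length v"
    proof -
      have "4 * l \<le> n" using m by (cases m) (auto simp: n_def)
      also have "n \<le> n * length y" using False by (cases y) auto
      also have "\<dots> = length v" by (simp add: v_def length_concat sum_list_replicate)
      finally show ?thesis .
    qed
    \<comment> \<open>Among the positions \<open>i = 0, l, 2 l\<close> at most one is off track before the shift and at most one
      after it, so some \<open>i\<close> is on track both times.\<close>
    have fit: "length g + i + 3 * l \<le> length w" "length g + length y + i + 3 * l \<le> length w"
      if "i \<le> l" for i using lv that by (simp_all add: w1)
    have "on_track w (length g + i) \<and> on_track w (length g + length y + i) \<longrightarrow> x \<in> H"
      if i: "i \<le> 2 * l" for i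
    proof
      assume t: "on_track w (length g + i) \<and> on_track w (length g + length y + i)"
      have iv: "i + l \<le> length v" using i lv by linarith
      have "window l (length g + i) w = window l i v" using iv by (simp add: w2)
      also have "\<dots> = window l (length g + length y + i) w" using iv by (simp add: w1)
      finally have win: "window l (length g + i) w = window l (length g + length y + i) w" .
      have wc: "w \<in> reduced_words A"
        using H_in_carrier[OF \<open>w \<in> H\<close>] by (simp add: carrier_free_group)
      let ?t = "take i v"
      have tk: "take (length g + i) w = g @ ?t" "take (length g + length y + i) w = g @ y @ ?t"
        using iv by (simp add: w2, simp add: w1)
      have red: "g @ ?t \<in> reduced_words A" "g @ y @ ?t \<in> reduced_words A"
        using take_in_reduced_words[OF wc] tk by metis+
      then have gt: "g \<otimes>\<^bsub>G\<^esub> ?t = g @ ?t" "g \<otimes>\<^bsub>G\<^esub> (y \<otimes>\<^bsub>G\<^esub> ?t) = g @ y @ ?t"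
        by (simp_all add: mult_append reduced_words_def reduced_append)
      have xy: "x = g \<otimes>\<^bsub>G\<^esub> (y \<otimes>\<^bsub>G\<^esub> word_inv g)"
        using xr xg by (simp add: mult_append reduced_words_def reduced_append)
      have mem: "g \<in> carrier G" "y \<in> carrier G" "?t \<in> carrier G" "word_inv g = inv\<^bsub>G\<^esub> g"
        using xr xg red append_in_reduced_words[of g "y @ ?t" A] append_in_reduced_words[of y ?t A]
        by (auto simp: carrier_free_group inv_free_group)
      have "inv\<^bsub>G\<^esub> g \<otimes>\<^bsub>G\<^esub> (g \<otimes>\<^bsub>G\<^esub> ?t) = ?t"
        using mem(1,3) by (simp flip: m_assoc)
      then have "x \<otimes>\<^bsub>G\<^esub> (g \<otimes>\<^bsub>G\<^esub> ?t) = g \<otimes>\<^bsub>G\<^esub> (y \<otimes>\<^bsub>G\<^esub> ?t)"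
        unfolding xy mem(4) using mem(1-3) by (simp add: m_assoc)
      then have "x \<otimes>\<^bsub>G\<^esub> take (length g + i) w = take (length g + length y + i) w"
        unfolding tk gt .
      then show "x \<in> H" using shift_in_H[OF _ _ win x] t by blast
    qed
    from this[of 0] this[of l] this[of "2 * l"]
    have H: "\<not> (on_track w (length g + 0) \<and> on_track w (length g + length y + 0))"
      "\<not> (on_track w (length g + l) \<and> on_track w (length g + length y + l))"
      "\<not> (on_track w (length g + (l + l)) \<and> on_track w (length g + length y + (l + l)))"
      if "x \<notin> H" using that by (simp_all add: mult_2)
    have "on_track w (length g + i) \<or> on_track w (length g + (i + l)) \<and> on_track w (length g + (i + 2 * l))"
      "on_track w (length g + length y + i) \<or> on_track w (length g + length y + (i + l))
        \<and> on_track w (length g + length y + (i + 2 * l))" if "i \<le> l" for i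
      using W[OF fit(1)[OF that]] W[OF fit(2)[OF that]] by (simp_all add: add.assoc)
    from this[of 0] this[of l] H show ?thesis unfolding mult_2 add_0_left by blast
  qed
qed

lemma pure_H: "pure_subgroup H G"
  unfolding pure_subgroup_def
proof (intro conjI ballI allI impI)
  show "subgroup H G" by (rule subgroup_H)
  fix x and m :: int
  assume x: "x \<in> carrier G" and m: "m \<noteq> 0" and xm: "x [^]\<^bsub>G\<^esub> m \<in> H"
  have "x [^]\<^bsub>G\<^esub> nat \<bar>m\<bar> \<in> H"
  proof (cases m rule: int_cases2)
    case (nonneg n)
    then show ?thesis using xm by (simp add: int_pow_int)
  next
    case (nonpos n)
    have "inv\<^bsub>G\<^esub> (x [^]\<^bsub>G\<^esub> m) \<in> H" using xm subgroup_H by (simp add: subgroup.m_inv_closed)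
    then show ?thesis using x nonpos by (simp add: int_pow_neg int_pow_int)
  qed
  then show "x \<in> H" using nat_root_in_H[OF x, of "nat \<bar>m\<bar>"] m by simp
qed

end


section \<open>Counting reduced words and tuples\<close>

definition words_of_length :: "'a set \<Rightarrow> nat \<Rightarrow> 'a letter list set" where
  "words_of_length A n = {w \<in> reduced_words A. length w = n}"

lemma finite_words_of_length:
  assumes "finite A" shows "finite (words_of_length A n)"
  by (rule finite_subset[OF _ finite_lists_length_eq[of "A \<times> UNIV" n]])
    (use assms in \<open>auto simp: words_of_length_def reduced_words_def\<close>)

text \<open>A nonempty reduced word is extended on the left by any letter except the inverse of its head.\<close>

lemma words_of_length_Suc_Suc:
  "words_of_length A (Suc (Suc n)) = (\<lambda>(w, x). x # w) `
     (SIGMA w : words_of_length A (Suc n). A \<times> UNIV - {inv_letter (hd w)})" (is "?L = ?R")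
proof
  show "?L \<subseteq> ?R"
  proof
    fix u assume u: "u \<in> ?L"
    then obtain x y w where "u = x # y # w" by (auto simp: words_of_length_def length_Suc_conv)
    with u show "u \<in> ?R"
      by (intro image_eqI[of _ _ "(y # w, x)"])
        (auto simp: words_of_length_def reduced_words_def reduced_def)
  qed
  show "?R \<subseteq> ?L"
  proof
    fix u assume "u \<in> ?R"
    then obtain w x where w: "w \<in> words_of_length A (Suc n)" and x: "x \<in> A \<times> UNIV" "x \<noteq> inv_letter (hd w)"
      and u: "u = x # w" by auto
    then obtain y v where "w = y # v" by (auto simp: words_of_length_def length_Suc_conv)
    with w x u show "u \<in> ?L"
      by (auto simp: words_of_length_def reduced_words_def reduced_def)
  qed
qed

lemma card_words_of_length:
  assumes A: "finite A" "A \<noteq> {}"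
  shows "card (words_of_length A (Suc n)) = 2 * card A * (2 * card A - 1) ^ n"
proof (induction n)
  case 0
  have "words_of_length A (Suc 0) = (\<lambda>x. [x]) ` (A \<times> UNIV)"
    by (auto simp: words_of_length_def reduced_words_def reduced_def length_Suc_conv)
  then show ?case using A by (simp add: card_image inj_on_def)
next
  case (Suc n)
  have "card (A \<times> UNIV - {inv_letter (hd w)}) = 2 * card A - 1"
    if "w \<in> words_of_length A (Suc n)" for w
  proof -
    have "inv_letter (hd w) \<in> A \<times> UNIV"
      using that by (cases w) (auto simp: words_of_length_def reduced_words_def inv_letter_def)
    then show ?thesis using A by (simp add: card_Diff_singleton)
  qed
  then have "card (SIGMA w : words_of_length A (Suc n). A \<times> UNIV - {inv_letter (hd w)})
      = card (words_of_length A (Suc n)) * (2 * card A - 1)"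
    using A by (subst card_SigmaI) (auto simp: finite_words_of_length)
  then show ?case unfolding words_of_length_Suc_Suc Suc
    by (subst card_image) (auto simp: inj_on_def)
qed

lemma card_words_of_length_bounds:
  assumes A: "finite A" "A \<noteq> {}"
  shows "(2 * card A - 1) ^ n \<le> card (words_of_length A n)"
    and "card (words_of_length A n) \<le> 2 * (2 * card A - 1) ^ n"
proof -
  have c: "card A \<ge> 1" using A by (simp add: Suc_leI card_gt_0_iff)
  have "(2 * card A - 1) ^ n \<le> card (words_of_length A n) \<and>
    card (words_of_length A n) \<le> 2 * (2 * card A - 1) ^ n"
  proof (cases n)
    case 0
    have "words_of_length A 0 = {[]}"
      by (auto simp: words_of_length_def reduced_words_def reduced_def)
    then show ?thesis using 0 by simp
  next
    case (Suc m)
    have "2 * card A - 1 \<le> 2 * card A" "2 * card A \<le> 2 * (2 * card A - 1)" using c by auto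
    then show ?thesis unfolding Suc card_words_of_length[OF A] power_Suc mult.assoc[symmetric]
      by (auto intro!: mult_le_mono1)
  qed
  then show "(2 * card A - 1) ^ n \<le> card (words_of_length A n)"
    and "card (words_of_length A n) \<le> 2 * (2 * card A - 1) ^ n" by auto
qed

lemma finite_reduced_words_upto:
  assumes "finite A" shows "finite (reduced_words_upto A n)"
  by (rule finite_subset[OF _ finite_lists_length_le[of "A \<times> UNIV" n]])
    (use assms in \<open>auto simp: reduced_words_upto_def reduced_words_def\<close>)

lemma card_reduced_words_upto_ge:
  assumes "finite A" "A \<noteq> {}"
  shows "(2 * card A - 1) ^ n \<le> card (reduced_words_upto A n)"
proof -
  have "card (words_of_length A n) \<le> card (reduced_words_upto A n)"
    by (rule card_mono[OF finite_reduced_words_upto])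
      (use assms in \<open>auto simp: words_of_length_def reduced_words_upto_def\<close>)
  with card_words_of_length_bounds(1)[OF assms] show ?thesis by (rule le_trans)
qed

lemma card_reduced_words_upto_le:
  assumes "finite A" "card A \<ge> 2"
  shows "card (reduced_words_upto A n) \<le> 3 * (2 * card A - 1) ^ n"
proof (induction n)
  case 0
  have "reduced_words_upto A 0 = {[]}"
    by (auto simp: reduced_words_upto_def reduced_words_def reduced_def)
  then show ?case by simp
next
  case (Suc n)
  let ?d = "2 * card A - 1"
  have "reduced_words_upto A (Suc n) = reduced_words_upto A n \<union> words_of_length A (Suc n)"
    by (auto simp: reduced_words_upto_def words_of_length_def)
  then have "card (reduced_words_upto A (Suc n))
      \<le> card (reduced_words_upto A n) + card (words_of_length A (Suc n))"
    by (simp add: card_Un_le)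
  also have "\<dots> \<le> 3 * ?d ^ n + 2 * ?d ^ Suc n"
    using Suc card_words_of_length_bounds(2)[of A "Suc n"] assms
    by (intro add_mono) fastforce+
  also have "3 * ?d ^ n \<le> ?d * ?d ^ n" using assms(2) by (intro mult_le_mono1) linarith
  finally show ?case by simp
qed

text \<open>A word of \<open>X\<close> can be recovered letter by letter from what is left after deleting the block, so
  \<open>X\<close> has at most as many elements as there are pairs of a word of length \<open>a\<close> and a word of length at
  most \<open>n - a - s\<close>.  The letters that determine a block letter may lie in the block itself, so
  overlapping repetitions are covered.\<close>

lemma card_block_determined:
  fixes X :: "'a letter list set"
  assumes A: "finite A" "card A \<ge> 2" and X: "X \<subseteq> reduced_words_upto A n"
    and len: "\<And>x. x \<in> X \<Longrightarrow> a + s \<le> length x"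
    and det: "\<And>x m. x \<in> X \<Longrightarrow> a \<le> m \<Longrightarrow> m < a + s \<Longrightarrow> x ! m = F m (take m x)"
  shows "card X * (2 * card A - 1) ^ s \<le> 6 * (2 * card A - 1) ^ n"
proof (cases "X = {}")
  case False
  let ?d = "2 * card A - 1"
  have as: "a + s \<le> n" using False len X by (fastforce simp: reduced_words_upto_def)
  have "inj_on (\<lambda>x. (take a x, drop (a + s) x)) X"
  proof (rule inj_onI)
    fix x y assume xy: "x \<in> X" "y \<in> X" and "(take a x, drop (a + s) x) = (take a y, drop (a + s) y)"
    then have t: "take a x = take a y" and d: "drop (a + s) x = drop (a + s) y" by auto
    have l: "length x = length y" using arg_cong[OF d, of length] len[OF xy(1)] len[OF xy(2)] by simp
    have "m < length x \<longrightarrow> x ! m = y ! m" for m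
    proof (induction m rule: less_induct)
      case (less m)
      consider "m < a" | "a \<le> m" "m < a + s" | "a + s \<le> m" by linarith
      then show ?case
      proof cases
        case 1
        then show ?thesis using arg_cong[OF t, of "\<lambda>z. z ! m"] by simp
      next
        case 2
        have "take m x = take m y" if "m < length x"
          using less that l by (intro nth_take_lemma) auto
        then show ?thesis using det[OF xy(1) 2] det[OF xy(2) 2] by auto
      next
        case 3
        then show ?thesis using arg_cong[OF d, of "\<lambda>z. z ! (m - (a + s))"] l by auto
      qed
    qed
    then show "x = y" using l by (simp add: nth_equalityI)
  qed
  then have "card X = card ((\<lambda>x. (take a x, drop (a + s) x)) ` X)" by (simp add: card_image)
  also have "\<dots> \<le> card (words_of_length A a \<times> reduced_words_upto A (n - a - s))"
  proof (rule card_mono)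
    show "finite (words_of_length A a \<times> reduced_words_upto A (n - a - s))"
      using A by (simp add: finite_words_of_length finite_reduced_words_upto)
    show "(\<lambda>x. (take a x, drop (a + s) x)) ` X \<subseteq> words_of_length A a \<times> reduced_words_upto A (n - a - s)"
    proof clarify
      fix x assume x: "x \<in> X"
      then have "x \<in> reduced_words A" "length x \<le> n" "a + s \<le> length x"
        using X len by (auto simp: reduced_words_upto_def)
      then show "take a x \<in> words_of_length A a \<and> drop (a + s) x \<in> reduced_words_upto A (n - a - s)"
        using append_in_reduced_words[of "take (a + s) x" "drop (a + s) x" A]
        by (auto simp: words_of_length_def reduced_words_upto_def take_in_reduced_words)
    qed
  qed
  also have "\<dots> \<le> (2 * ?d ^ a) * (3 * ?d ^ (n - a - s))"
    unfolding card_cartesian_product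
    by (rule mult_le_mono)
      (use card_words_of_length_bounds(2)[of A a] card_reduced_words_upto_le[of A] A in fastforce)+
  finally have "card X * ?d ^ s \<le> 6 * (?d ^ a * ?d ^ (n - a - s) * ?d ^ s)" by simp
  also have "?d ^ a * ?d ^ (n - a - s) * ?d ^ s = ?d ^ n"
    using as by (simp flip: power_add)
  finally show ?thesis .
qed simp

lemma tuples_eq: "tuples k S = {xs. set xs \<subseteq> S \<and> length xs = k}"
  by (auto simp: tuples_def)

lemma finite_tuples: "finite S \<Longrightarrow> finite (tuples k S)"
  by (simp add: tuples_eq finite_lists_length_eq)

lemma card_tuples: "finite S \<Longrightarrow> card (tuples k S) = card S ^ k"
  by (simp add: tuples_eq card_lists_length_eq)

lemma card_tuples_coordinate:
  assumes S: "finite S" and j: "j < k" and B: "B \<subseteq> tuples k S"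
    and N: "\<And>hs. hs \<in> tuples k S \<Longrightarrow> card {x \<in> S. hs[j := x] \<in> B} \<le> N"
  shows "card B \<le> N * card S ^ (k - 1)"
proof -
  define ins where "ins ts x = take j ts @ x # drop j ts" for ts and x :: 'a
  have B_sub: "B \<subseteq> (\<Union>ts \<in> tuples (k - 1) S. ins ts ` {x \<in> S. ins ts x \<in> B})"
  proof
    fix hs assume hs: "hs \<in> B"
    then have l: "length hs = k" and sub: "set hs \<subseteq> S" using B by (auto simp: tuples_def)
    let ?ts = "take j hs @ drop (Suc j) hs"
    have "ins ?ts (hs ! j) = hs" using j l by (simp add: ins_def id_take_nth_drop[symmetric])
    moreover have "?ts \<in> tuples (k - 1) S"
      using sub j l set_take_subset[of j hs] set_drop_subset[of "Suc j" hs] by (auto simp: tuples_def)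
    moreover have "hs ! j \<in> S" using sub j l by auto
    ultimately show "hs \<in> (\<Union>ts \<in> tuples (k - 1) S. ins ts ` {x \<in> S. ins ts x \<in> B})"
      using hs by (metis (mono_tags, lifting) UN_I image_eqI mem_Collect_eq)
  qed
  have fibre: "card (ins ts ` {x \<in> S. ins ts x \<in> B}) \<le> N" if ts: "ts \<in> tuples (k - 1) S" for ts
  proof (cases "{x \<in> S. ins ts x \<in> B} = {}")
    case False
    then obtain x0 where "ins ts x0 \<in> B" by blast
    then have "ins ts x0 \<in> tuples k S" using B by auto
    moreover have "(ins ts x0)[j := x] = ins ts x" for x
      using ts j by (simp add: ins_def tuples_def list_update_append)
    ultimately have "card {x \<in> S. ins ts x \<in> B} \<le> N" using N[of "ins ts x0"] by simp
    with card_image_le[of "{x \<in> S. ins ts x \<in> B}" "ins ts"] S show ?thesis by simp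
  qed (simp only: image_empty card.empty le0)
  have "card B \<le> card (\<Union>ts \<in> tuples (k - 1) S. ins ts ` {x \<in> S. ins ts x \<in> B})"
    by (rule card_mono[OF _ B_sub]) (use S in \<open>auto simp: finite_tuples\<close>)
  also have "\<dots> \<le> (\<Sum>ts \<in> tuples (k - 1) S. card (ins ts ` {x \<in> S. ins ts x \<in> B}))"
    by (rule card_UN_le) (use S in \<open>simp add: finite_tuples\<close>)
  also have "\<dots> \<le> (\<Sum>ts \<in> tuples (k - 1) S. N)" by (rule sum_mono) (rule fibre)
  also have "\<dots> = N * card S ^ (k - 1)" using S by (simp add: card_tuples)
  finally show ?thesis .
qed

text \<open>The event is conditioned on all words of the tuple but the \<open>j\<close>-th.\<close>

lemma card_tuples_rare_coordinate:
  assumes A: "finite A" "card A \<ge> 2" and j: "j < k" and B: "B \<subseteq> tuples k (reduced_words_upto A n)"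
    and rare: "\<And>hs. hs \<in> tuples k (reduced_words_upto A n) \<Longrightarrow>
      card {x \<in> reduced_words_upto A n. hs[j := x] \<in> B} * (2 * card A - 1) ^ s \<le> 6 * (2 * card A - 1) ^ n"
  shows "card B * (2 * card A - 1) ^ s \<le> 6 * card (reduced_words_upto A n) ^ k"
proof -
  let ?R = "reduced_words_upto A n" and ?d = "2 * card A - 1"
  define N where "N = 6 * ?d ^ n div ?d ^ s"
  have d: "?d > 0" using A by simp
  have "card B \<le> N * card ?R ^ (k - 1)"
  proof (rule card_tuples_coordinate[OF _ j B])
    show "finite ?R" using A by (simp add: finite_reduced_words_upto)
    fix hs assume "hs \<in> tuples k ?R"
    from rare[OF this] show "card {x \<in> ?R. hs[j := x] \<in> B} \<le> N"
      unfolding N_def using d by (simp add: less_eq_div_iff_mult_less_eq)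
  qed
  then have "card B * ?d ^ s \<le> (N * ?d ^ s) * card ?R ^ (k - 1)"
    using mult_le_mono1[of "card B" _ "?d ^ s"] by (simp add: ac_simps)
  also have "\<dots> \<le> (6 * ?d ^ n) * card ?R ^ (k - 1)"
    unfolding N_def by (intro mult_le_mono1) (rule div_times_less_eq_dividend)
  also have "\<dots> \<le> (6 * card ?R) * card ?R ^ (k - 1)"
    using card_reduced_words_upto_ge[of A n] A by (intro mult_le_mono1 mult_le_mono2) fastforce
  also have "\<dots> = 6 * card ?R ^ k" using j by (cases k) auto
  finally show ?thesis .
qed

lemma card_tuples_short:
  assumes A: "finite A" "card A \<ge> 2" and i: "i < k" and s: "16 * s \<le> n"
  shows "card {hs \<in> tuples k (reduced_words_upto A n). length (hs ! i) < 10 * s} * (2 * card A - 1) ^ s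
    \<le> 6 * card (reduced_words_upto A n) ^ k"
proof (rule card_tuples_rare_coordinate[OF A i])
  let ?d = "2 * card A - 1" and ?B = "{hs \<in> tuples k (reduced_words_upto A n). length (hs ! i) < 10 * s}"
  fix hs assume hs: "hs \<in> tuples k (reduced_words_upto A n)"
  have "card {x \<in> reduced_words_upto A n. hs[i := x] \<in> ?B} \<le> card (reduced_words_upto A (10 * s))"
    by (rule card_mono) (use A i hs in \<open>auto simp: tuples_def reduced_words_upto_def
      finite_reduced_words_upto[unfolded reduced_words_upto_def]\<close>)
  also have "\<dots> \<le> 3 * ?d ^ (10 * s)" using card_reduced_words_upto_le A by blast
  finally have "card {x \<in> reduced_words_upto A n. hs[i := x] \<in> ?B} * ?d ^ s \<le> 3 * ?d ^ (10 * s) * ?d ^ s"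
    by (rule mult_le_mono1)
  also have "\<dots> = 3 * ?d ^ (10 * s + s)" by (simp only: power_add mult.assoc)
  also have "\<dots> \<le> 6 * ?d ^ n" using A s by (intro mult_le_mono power_increasing) auto
  finally show "card {x \<in> reduced_words_upto A n. hs[i := x] \<in> ?B} * ?d ^ s \<le> 6 * ?d ^ n" .
qed auto

text \<open>Common form of the coincidences below: each letter of a block of the \<open>j\<close>-th word is copied,
  through \<open>f\<close>, from the \<open>i\<close>-th word, and if the two words are the same then from an earlier place.\<close>

lemma card_tuples_block_copied:
  assumes A: "finite A" "card A \<ge> 2" and ij: "i < k" "j < k"
    and B: "B \<subseteq> tuples k (reduced_words_upto A n)"
    and len: "\<And>hs. hs \<in> B \<Longrightarrow> a + s \<le> length (hs ! j)"
    and copy: "\<And>hs m. hs \<in> B \<Longrightarrow> a \<le> m \<Longrightarrow> m < a + s \<Longrightarrow> hs ! j ! m = f (hs ! i ! \<phi> m)"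
    and earlier: "\<And>m. i = j \<Longrightarrow> a \<le> m \<Longrightarrow> m < a + s \<Longrightarrow> \<phi> m < m"
  shows "card B * (2 * card A - 1) ^ s \<le> 6 * card (reduced_words_upto A n) ^ k"
proof (rule card_tuples_rare_coordinate[OF A ij(2) B])
  fix hs assume hs: "hs \<in> tuples k (reduced_words_upto A n)"
  let ?F = "\<lambda>m w. f ((if i = j then w else hs ! i) ! \<phi> m)"
  have l: "length hs = k" using hs by (simp add: tuples_def)
  show "card {x \<in> reduced_words_upto A n. hs[j := x] \<in> B} * (2 * card A - 1) ^ s \<le> 6 * (2 * card A - 1) ^ n"
  proof (rule card_block_determined[OF A, where F = ?F and a = a])
    fix x assume x: "x \<in> {x \<in> reduced_words_upto A n. hs[j := x] \<in> B}"
    then show "a + s \<le> length x" using len[of "hs[j := x]"] l ij by simp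
    fix m assume m: "a \<le> m" "m < a + s"
    have "x ! m = f (hs[j := x] ! i ! \<phi> m)"
      using copy[of "hs[j := x]" m] x m l ij by simp
    then show "x ! m = ?F m (take m x)" using earlier[of m] m l ij by auto
  qed auto
qed

section \<open>Rare coincidences\<close>

text \<open>In both events the two places are ordered when they belong to the same word.  This loses no
  coincidence, since both relations between the windows are symmetric
  (\<open>not_distinct_windows_event\<close>).  In the second event \<open>p = q\<close> is a coincidence as well.\<close>

definition equal_windows_event where
  "equal_windows_event A k n s i j p q = {hs \<in> tuples k (reduced_words_upto A n).
     (i \<noteq> j \<or> p < q) \<and> p + 2 * s \<le> length (hs ! i) \<and> q + 2 * s \<le> length (hs ! j) \<and>
     window (2 * s) p (hs ! i) = window (2 * s) q (hs ! j)}"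

definition inverse_windows_event where
  "inverse_windows_event A k n s i j p q = {hs \<in> tuples k (reduced_words_upto A n).
     (i \<noteq> j \<or> p \<le> q) \<and> p + 2 * s \<le> length (hs ! i) \<and> q + 2 * s \<le> length (hs ! j) \<and>
     window (2 * s) p (hs ! i) = word_inv (window (2 * s) q (hs ! j))}"

lemma card_equal_windows_event:
  assumes A: "finite A" "card A \<ge> 2" and ij: "i < k" "j < k"
  shows "card (equal_windows_event A k n s i j p q) * (2 * card A - 1) ^ s
    \<le> 6 * card (reduced_words_upto A n) ^ k"
proof (cases "i \<noteq> j \<or> p < q")
  case True
  show ?thesis
  proof (rule card_tuples_block_copied[OF A ij, where a = "q + s" and \<phi> = "\<lambda>m. p + m - q" and f = id])
    fix hs m assume hs: "hs \<in> equal_windows_event A k n s i j p q" and m: "q + s \<le> m" "m < q + s + s"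
    have "window (2 * s) p (hs ! i) ! (m - q) = window (2 * s) q (hs ! j) ! (m - q)"
      using hs by (simp add: equal_windows_event_def)
    then show "hs ! j ! m = id (hs ! i ! (p + m - q))"
      using hs m by (simp add: equal_windows_event_def)
  qed (use True in \<open>auto simp: equal_windows_event_def\<close>)
qed (simp add: equal_windows_event_def)

text \<open>The two windows may overlap, and then the inversion does not always copy from earlier letters.
  It does for the second half of the window at \<open>q\<close>, which is the inverse of the first half of the
  window at \<open>p \<le> q\<close>.  This is why windows have length \<open>2 * s\<close> and blocks length \<open>s\<close>.\<close>

lemma card_inverse_windows_event:
  assumes A: "finite A" "card A \<ge> 2" and ij: "i < k" "j < k"
  shows "card (inverse_windows_event A k n s i j p q) * (2 * card A - 1) ^ s
    \<le> 6 * card (reduced_words_upto A n) ^ k"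
proof (cases "i \<noteq> j \<or> p \<le> q")
  case True
  show ?thesis
  proof (rule card_tuples_block_copied[OF A ij, where a = "q + s" and f = inv_letter
        and \<phi> = "\<lambda>m. p + (2 * s - Suc (m - q))"])
    fix hs m assume hs: "hs \<in> inverse_windows_event A k n s i j p q" and m: "q + s \<le> m" "m < q + s + s"
    then have "word_inv (window (2 * s) p (hs ! i)) = window (2 * s) q (hs ! j)"
      by (simp add: inverse_windows_event_def)
    then have eq: "word_inv (window (2 * s) p (hs ! i)) ! (m - q) = window (2 * s) q (hs ! j) ! (m - q)"
      by (rule arg_cong)
    show "hs ! j ! m = inv_letter (hs ! i ! (p + (2 * s - Suc (m - q))))"
    proof -
      have "length (window (2 * s) p (hs ! i)) = 2 * s" "q + 2 * s \<le> length (hs ! j)"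
        using hs by (auto simp: inverse_windows_event_def)
      with eq m show ?thesis by (simp add: word_inv_def rev_nth)
    qed
  qed (use True in \<open>auto simp: inverse_windows_event_def\<close>)
qed (simp add: inverse_windows_event_def)

lemma not_distinct_windows_event:
  assumes hs: "hs \<in> tuples k (reduced_words_upto A n)" and bad: "\<not> distinct_windows (2 * s) hs"
  shows "\<exists>i<k. \<exists>j<k. \<exists>p\<le>n. \<exists>q\<le>n. hs \<in> equal_windows_event A k n s i j p q \<union> inverse_windows_event A k n s i j p q"
proof -
  have l: "length hs = k" and len: "\<And>i. i < k \<Longrightarrow> length (hs ! i) \<le> n"
    using hs nth_mem[of _ hs] by (force simp: tuples_def reduced_words_upto_def)+
  from bad obtain i j p q where ij: "i < k" "j < k" "p + 2 * s \<le> length (hs ! i)" "q + 2 * s \<le> length (hs ! j)"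
    and "(window (2 * s) p (hs ! i) = window (2 * s) q (hs ! j) \<and> (i \<noteq> j \<or> p \<noteq> q)) \<or>
       window (2 * s) p (hs ! i) = word_inv (window (2 * s) q (hs ! j))"
    unfolding distinct_windows_def l by blast
  moreover have "p \<le> n" "q \<le> n" using len[of i] len[of j] ij by linarith+
  moreover have "word_inv (window (2 * s) p (hs ! i)) = window (2 * s) q (hs ! j)"
    if "window (2 * s) p (hs ! i) = word_inv (window (2 * s) q (hs ! j))"
    using that by simp
  ultimately have "hs \<in> equal_windows_event A k n s i j p q \<union> inverse_windows_event A k n s i j p q \<or>
      hs \<in> equal_windows_event A k n s j i q p \<union> inverse_windows_event A k n s j i q p"
    using hs unfolding equal_windows_event_def inverse_windows_event_def by auto
  then show ?thesis using ij \<open>p \<le> n\<close> \<open>q \<le> n\<close> by blast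
qed

lemma card_impure_tuples:
  assumes A: "finite A" "card A \<ge> 2" and k: "k \<ge> 1" and s: "16 * s \<le> n"
  shows "card {hs \<in> tuples k (reduced_words_upto A n).
        \<not> pure_subgroup (generate (free_group A) (set hs)) (free_group A)} * (2 * card A - 1) ^ s
    \<le> 18 * k\<^sup>2 * (n + 1)\<^sup>2 * card (reduced_words_upto A n) ^ k" (is "card ?Bad * ?d ^ s \<le> _")
proof -
  let ?R = "reduced_words_upto A n"
  let ?short = "\<lambda>i. {hs \<in> tuples k ?R. length (hs ! i) < 10 * s}"
  let ?E = "equal_windows_event A k n s" and ?I = "inverse_windows_event A k n s"
  let ?J = "{..<k} \<times> {..<k} \<times> {..n} \<times> {..n}"
  have fin: "finite (tuples k ?R)" using A by (simp add: finite_tuples finite_reduced_words_upto)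
  let ?U = "(\<Union>i<k. ?short i) \<union> ((\<Union>(i,j,p,q)\<in>?J. ?E i j p q) \<union> (\<Union>(i,j,p,q)\<in>?J. ?I i j p q))"
  have "?Bad \<subseteq> ?U"
  proof
    fix hs assume bad: "hs \<in> ?Bad"
    then have hs: "hs \<in> tuples k ?R" by simp
    show "hs \<in> ?U"
    proof (cases "\<exists>i<k. length (hs ! i) < 10 * s")
      case True
      then show ?thesis using hs by blast
    next
      case False
      have "\<not> separated_tuple A hs (2 * s)" using bad separated_tuple.pure_H by blast
      moreover have "set hs \<subseteq> reduced_words A" using hs by (auto simp: tuples_def reduced_words_upto_def)
      moreover have "\<And>h. h \<in> set hs \<Longrightarrow> 5 * (2 * s) \<le> length h"
        using False hs by (fastforce simp: tuples_def in_set_conv_nth)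
      ultimately have "\<not> distinct_windows (2 * s) hs" unfolding separated_tuple_def by blast
      from not_distinct_windows_event[OF hs this] obtain i j p q
        where J: "(i, j, p, q) \<in> ?J" and "hs \<in> ?E i j p q \<union> ?I i j p q" by auto
      then consider "hs \<in> ?E i j p q" | "hs \<in> ?I i j p q" by blast
      then show ?thesis
      proof cases
        case 1
        with J have "hs \<in> (\<Union>(i,j,p,q)\<in>?J. ?E i j p q)" by (intro UN_I[OF J]) simp
        then show ?thesis by (intro UnI2 UnI1)
      next
        case 2
        with J have "hs \<in> (\<Union>(i,j,p,q)\<in>?J. ?I i j p q)" by (intro UN_I[OF J]) simp
        then show ?thesis by (intro UnI2)
      qed
    qed
  qed
  then have "card ?Bad \<le> card ?U"
    by (rule card_mono[rotated]) (auto simp: equal_windows_event_def inverse_windows_event_def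
        intro!: finite_subset[OF _ fin])
  also have "\<dots> \<le> (\<Sum>i<k. card (?short i)) +
      ((\<Sum>(i,j,p,q)\<in>?J. card (?E i j p q)) + (\<Sum>(i,j,p,q)\<in>?J. card (?I i j p q)))"
    by (intro order.trans[OF card_Un_le] add_mono order.trans[OF card_UN_le])
      (auto simp: case_prod_beta intro!: order.refl)
  finally have "card ?Bad * ?d ^ s \<le> (\<Sum>i<k. card (?short i) * ?d ^ s) +
      ((\<Sum>(i,j,p,q)\<in>?J. card (?E i j p q) * ?d ^ s) + (\<Sum>(i,j,p,q)\<in>?J. card (?I i j p q) * ?d ^ s))"
    by (auto simp: case_prod_beta sum_distrib_right[symmetric] add_mult_distrib[symmetric] intro: mult_le_mono1)
  also have "\<dots> \<le> (\<Sum>i<k. 6 * card ?R ^ k) +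
      ((\<Sum>(i,j,p,q)\<in>?J. 6 * card ?R ^ k) + (\<Sum>(i,j,p,q)\<in>?J. 6 * card ?R ^ k))"
    using card_tuples_short[OF A _ s] card_equal_windows_event[OF A] card_inverse_windows_event[OF A]
    by (intro add_mono sum_mono) (auto simp: case_prod_beta)
  also have "\<dots> = 6 * (k + 2 * (k\<^sup>2 * (n + 1)\<^sup>2)) * card ?R ^ k"
    by (simp add: case_prod_beta card_cartesian_product power2_eq_square algebra_simps)
  also have "\<dots> \<le> 6 * (3 * (k\<^sup>2 * (n + 1)\<^sup>2)) * card ?R ^ k"
  proof -
    have "k * 1 \<le> k\<^sup>2 * (n + 1)\<^sup>2" using k by (intro mult_le_mono) (auto simp: power2_eq_square)
    then show ?thesis by (intro mult_le_mono1 mult_le_mono2) linarith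
  qed
  finally show ?thesis by simp
qed

theorem corollary4p4:
  fixes A :: "'a set" and r k :: nat
  assumes "finite A" and "card A = r" and "r \<ge> 2" and "k \<ge> 1"
  shows "\<exists>c::real. c > 0 \<and>
    (\<lambda>n::nat.
       real (card {hs \<in> tuples k (reduced_words_upto A n).
                     \<not> pure_subgroup (generate (free_group A) (set hs)) (free_group A)})
       / real (card (reduced_words_upto A n)) ^ k)
    \<in> O(\<lambda>n. exp (- c * real n))"
proof (intro exI[of _ "1/32"] conjI)
  \<comment> \<open>The bound is a polynomial times \<open>exp (- n / 16)\<close>; half of the exponent absorbs the polynomial.\<close>
  let ?bad = "\<lambda>n. real (card {hs \<in> tuples k (reduced_words_upto A n).
    \<not> pure_subgroup (generate (free_group A) (set hs)) (free_group A)})"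
  let ?R = "\<lambda>n. real (card (reduced_words_upto A n))"
  have A: "finite A" "card A \<ge> 2" "A \<noteq> {}" using assms by auto
  have bound: "?bad n / ?R n ^ k \<le> 18 * (real k)\<^sup>2 * ((real n + 1)\<^sup>2 * exp (1 - real n / 16))" for n
  proof -
    define s where "s = n div 16"
    \<comment> \<open>\<open>2 * card A - 1 \<ge> 3 > e\<close>, and the 1 in the exponent pays for rounding in \<open>s\<close>.\<close>
    have "exp (real n / 16 - 1) \<le> exp (real s)"
      unfolding s_def by (simp add: field_simps)
    also have "\<dots> = exp 1 ^ s" by (simp add: exp_of_nat_mult[symmetric])
    also have "\<dots> \<le> 3 ^ s" by (intro power_mono exp_le) simp
    also have "\<dots> \<le> real ((2 * card A - 1) ^ s)"
      unfolding of_nat_power using A by (intro power_mono) auto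
    finally have e: "exp (real n / 16 - 1) \<le> real ((2 * card A - 1) ^ s)" .
    have R: "?R n > 0"
      using card_reduced_words_upto_ge[OF A(1,3), of n] A(2) by (simp add: less_le_trans[rotated])
    have "?bad n * real ((2 * card A - 1) ^ s) \<le> 18 * (real k)\<^sup>2 * (real n + 1)\<^sup>2 * ?R n ^ k"
    proof -
      have "real (card {hs \<in> tuples k (reduced_words_upto A n).
          \<not> pure_subgroup (generate (free_group A) (set hs)) (free_group A)} * (2 * card A - 1) ^ s)
        \<le> real (18 * k\<^sup>2 * (n + 1)\<^sup>2 * card (reduced_words_upto A n) ^ k)"
        by (rule of_nat_mono) (rule card_impure_tuples, use A assms in \<open>auto simp: s_def\<close>)
      then show ?thesis by (simp add: add.commute)
    qed
    with e have "?bad n * exp (real n / 16 - 1) \<le> 18 * (real k)\<^sup>2 * (real n + 1)\<^sup>2 * ?R n ^ k"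
      by (meson mult_left_mono of_nat_0_le_iff order_trans)
    then have "?bad n / ?R n ^ k \<le> 18 * (real k)\<^sup>2 * (real n + 1)\<^sup>2 / exp (real n / 16 - 1)"
      by (simp only: times_divide_eq_left pos_divide_le_eq[OF zero_less_power[OF R]]
          pos_le_divide_eq[OF exp_gt_zero])
    also have "\<dots> = 18 * (real k)\<^sup>2 * ((real n + 1)\<^sup>2 * exp (1 - real n / 16))"
      unfolding exp_minus[of "real n / 16 - 1", unfolded minus_diff_eq]
      by (simp only: divide_inverse mult.assoc)
    finally show ?thesis .
  qed
  have "(\<lambda>n. ?bad n / ?R n ^ k) \<in> O(\<lambda>n. 18 * (real k)\<^sup>2 * ((real n + 1)\<^sup>2 * exp (1 - real n / 16)))"
    by (rule landau_o.big_mono) (use bound in \<open>auto intro!: always_eventually\<close>)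
  also have "(\<lambda>n. 18 * (real k)\<^sup>2 * ((real n + 1)\<^sup>2 * exp (1 - real n / 16)))
      \<in> O(\<lambda>n. (real n + 1)\<^sup>2 * exp (1 - real n / 16))" by simp
  also have "(\<lambda>n::nat. (real n + 1)\<^sup>2 * exp (1 - real n / 16)) \<in> O(\<lambda>n. exp (- (1/32) * real n))"
    by real_asymp
  finally show "(\<lambda>n. ?bad n / ?R n ^ k) \<in> O(\<lambda>n. exp (- (1/32) * real n))" .
qed simp

end
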